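(* Let $(\mathrm{X}, \varphi)$ be a measure-preserving system on a probability space $\mathrm{X} = (X,\Sigma,\mu)$, let $\varepsilon > 0$ and let $\alpha$ be a finite $\Sigma$-measurable partition of $X$. Then there exist $K_0 \in \mathbb{N}$ and $\delta > 0$ with the following property: whenever $K \geq K_0$ and $\hat T \colon \mathrm{L}^2(\mathrm{X} \mid \alpha) \to \mathrm{L}^2(\mathrm{X} \mid \alpha)$ is a linear operator such that $$\lVert \hat T^k f - T_\varphi^k f \rVert_2 \leq \delta \lVert f \rVert_2 \quad \text{for all } f \in \mathrm{L}^2(\mathrm{X} \mid \alpha) \text{ and all } k \in \{0, \dots, K-1\},$$ then $$\lvert \alpha \rvert \geq \exp\bigl(K ( h_\mu(\varphi, \alpha) - \varepsilon)\bigr).$$ Here $\delta$ depends only on the system $(\mathrm{X}, \varphi)$, on $\varepsilon$ and on the cardinality $|\alpha|$ (i.e. for a fixed system, fixed $\varepsilon$ and fixed cardinality, the same $\delta$ works for all finite $\Sigma$-measurable partitions $\alpha$ of that cardinality, while $K_0$ may depend on $\alpha$).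
   Context: A measure-preserving (dynamical) system $(\mathrm{X},\varphi)$ consists of a probability space $\mathrm{X}=(X,\Sigma,\mu)$ and a $\Sigma$-measurable map $\varphi\colon X\to X$ with $\mu(\varphi^{-1}(A))=\mu(A)$ for all $A\in\Sigma$. $\mathrm{L}^2(\mathrm{X})$ is the usual space of (classes of) square-integrable functions $X\to\mathbb{K}$, $\mathbb{K}\in\{\mathbb{R},\mathbb{C}\}$, with norm $\lVert\cdot\rVert_2$. The Koopman operator is $T_\varphi\colon \mathrm{L}^2(\mathrm{X})\to \mathrm{L}^2(\mathrm{X})$, $T_\varphi f = f\circ\varphi$. A $\Sigma$-measurable partition is a partition of $X$ into sets from $\Sigma$. For a finite $\Sigma$-measurable partition $\alpha$, $\mathrm{L}^2(\mathrm{X}\mid\alpha) := \operatorname{span}\{\mathbf{1}_A : A\in\alpha\}\subseteq \mathrm{L}^2(\mathrm{X})$. The static entropy is $H_\mu(\alpha) := \sum_{A\in\alpha} -\mu(A)\log\mu(A)$, where the sum omits sets of measure zero. The common refinement is $\alpha\vee\beta := \{A\cap B : A\in\alpha, B\in\beta\}$ (and analogously for finitely many partitions), and $\varphi^{-k}(\alpha) := \{\varphi^{-k}(A) : A\in\alpha\}$. The measure-theoretic entropy of $\alpha$ with respect to $\varphi$ is $h_\mu(\varphi,\alpha) := \lim_{n\to\infty}\frac1n H_\mu\bigl(\bigvee_{k=0}^{n-1}\varphi^{-k}(\alpha)\bigr)$ (the limit exists). *)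

theory Defs
  imports "HOL-Probability.Probability"
begin

text \<open>
  The scalar field \<open>\<bbbK>\<close> is a type \<open>'k\<close> of sort \<open>{real_normed_field, euclidean_space}\<close>:
  \<^typ>\<open>real\<close> and \<^typ>\<open>complex\<close> are instances and, by Frobenius' theorem, up to isomorphism
  the only ones.
\<close>

locale measure_preserving_system = prob_space M for M :: "'a measure" +
  fixes \<phi> :: "'a \<Rightarrow> 'a"
  assumes measurable_map: "\<phi> \<in> M \<rightarrow>\<^sub>M M"
    and measure_vimage: "A \<in> sets M \<Longrightarrow> measure M (\<phi> -` A \<inter> space M) = measure M A"


subsection \<open>The space of square-integrable functions modulo equality almost everywhere\<close>

text \<open>
  Since the carrier depends on the measure, an element of \<open>L\<^sup>2(M)\<close> is represented by the set of all
  measurable functions in its class. Operations are computed on an arbitrary representative; the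
  lemmas below show that the choice does not matter.
\<close>

definition ae_class :: "'a measure \<Rightarrow> ('a \<Rightarrow> 'k::{real_normed_field, euclidean_space}) \<Rightarrow> ('a \<Rightarrow> 'k) set" where
  "ae_class M f = {g \<in> borel_measurable M. AE x in M. g x = f x}"

definition rep :: "('a \<Rightarrow> 'k) set \<Rightarrow> 'a \<Rightarrow> 'k" where
  "rep F = (SOME f. f \<in> F)"

definition L2 :: "'a measure \<Rightarrow> ('a \<Rightarrow> 'k::{real_normed_field, euclidean_space}) set set" where
  "L2 M = {ae_class M f | f. f \<in> borel_measurable M \<and> integrable M (\<lambda>x. (norm (f x))\<^sup>2)}"

definition L2_add :: "'a measure \<Rightarrow> ('a \<Rightarrow> 'k::{real_normed_field, euclidean_space}) set \<Rightarrow>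
    ('a \<Rightarrow> 'k) set \<Rightarrow> ('a \<Rightarrow> 'k) set" where
  "L2_add M F G = ae_class M (\<lambda>x. rep F x + rep G x)"

definition L2_diff :: "'a measure \<Rightarrow> ('a \<Rightarrow> 'k::{real_normed_field, euclidean_space}) set \<Rightarrow>
    ('a \<Rightarrow> 'k) set \<Rightarrow> ('a \<Rightarrow> 'k) set" where
  "L2_diff M F G = ae_class M (\<lambda>x. rep F x - rep G x)"

definition L2_scale :: "'a measure \<Rightarrow> 'k::{real_normed_field, euclidean_space} \<Rightarrow>
    ('a \<Rightarrow> 'k) set \<Rightarrow> ('a \<Rightarrow> 'k) set" where
  "L2_scale M c F = ae_class M (\<lambda>x. c * rep F x)"

definition L2_norm :: "'a measure \<Rightarrow> ('a \<Rightarrow> 'k::{real_normed_field, euclidean_space}) set \<Rightarrow> real" where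
  "L2_norm M F = sqrt (LINT x|M. (norm (rep F x))\<^sup>2)"

definition koopman :: "'a measure \<Rightarrow> ('a \<Rightarrow> 'a) \<Rightarrow>
    ('a \<Rightarrow> 'k::{real_normed_field, euclidean_space}) set \<Rightarrow> ('a \<Rightarrow> 'k) set" where
  "koopman M \<phi> F = ae_class M (rep F \<circ> \<phi>)"

text \<open>Nothing is required of \<open>T\<close> outside the subspace \<open>V\<close>.\<close>

definition L2_linear_operator_on :: "'a measure \<Rightarrow> ('a \<Rightarrow> 'k::{real_normed_field, euclidean_space}) set set \<Rightarrow>
    (('a \<Rightarrow> 'k) set \<Rightarrow> ('a \<Rightarrow> 'k) set) \<Rightarrow> bool" where
  "L2_linear_operator_on M V T \<longleftrightarrow>
     (\<forall>F\<in>V. T F \<in> V) \<and>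
     (\<forall>F\<in>V. \<forall>G\<in>V. T (L2_add M F G) = L2_add M (T F) (T G)) \<and>
     (\<forall>c. \<forall>F\<in>V. T (L2_scale M c F) = L2_scale M c (T F))"

lemma ae_class_self: "f \<in> borel_measurable M \<Longrightarrow> f \<in> ae_class M f"
  by (simp add: ae_class_def)

lemma ae_class_eq_iff:
  assumes "f \<in> borel_measurable M" "g \<in> borel_measurable M"
  shows "ae_class M f = ae_class M g \<longleftrightarrow> (AE x in M. f x = g x)"
proof
  assume "ae_class M f = ae_class M g"
  then have "f \<in> ae_class M g"
    using ae_class_self[OF assms(1)] by simp
  then show "AE x in M. f x = g x"
    by (simp add: ae_class_def)
next
  assume "AE x in M. f x = g x"
  then have "(AE x in M. h x = f x) \<longleftrightarrow> (AE x in M. h x = g x)" for h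
    by (auto elim: AE_mp)
  then show "ae_class M f = ae_class M g"
    by (simp add: ae_class_def)
qed

lemma rep_ae_class:
  assumes "f \<in> borel_measurable M"
  shows "rep (ae_class M f) \<in> borel_measurable M" "AE x in M. rep (ae_class M f) x = f x"
proof -
  have "rep (ae_class M f) \<in> ae_class M f"
    unfolding rep_def using ae_class_self[OF assms] by (rule someI[where P = "\<lambda>g. g \<in> ae_class M f"])
  then show "rep (ae_class M f) \<in> borel_measurable M" "AE x in M. rep (ae_class M f) x = f x"
    by (simp_all add: ae_class_def)
qed

lemma ae_class_cong:
  assumes "AE x in M. f x = g x"
  shows "ae_class M f = ae_class M g"
proof -
  have "(AE x in M. h x = f x) \<longleftrightarrow> (AE x in M. h x = g x)" for h
    using assms by (auto elim: AE_mp)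
  then show ?thesis
    by (simp add: ae_class_def)
qed

lemma L2_add_ae_class:
  assumes "f \<in> borel_measurable M" "g \<in> borel_measurable M"
  shows "L2_add M (ae_class M f) (ae_class M g) = ae_class M (\<lambda>x. f x + g x)"
proof (unfold L2_add_def, rule ae_class_cong)
  show "AE x in M. rep (ae_class M f) x + rep (ae_class M g) x = f x + g x"
    using rep_ae_class(2)[OF assms(1)] rep_ae_class(2)[OF assms(2)] by eventually_elim simp
qed

lemma L2_diff_ae_class:
  assumes "f \<in> borel_measurable M" "g \<in> borel_measurable M"
  shows "L2_diff M (ae_class M f) (ae_class M g) = ae_class M (\<lambda>x. f x - g x)"
proof (unfold L2_diff_def, rule ae_class_cong)
  show "AE x in M. rep (ae_class M f) x - rep (ae_class M g) x = f x - g x"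
    using rep_ae_class(2)[OF assms(1)] rep_ae_class(2)[OF assms(2)] by eventually_elim simp
qed

lemma L2_scale_ae_class:
  assumes "f \<in> borel_measurable M"
  shows "L2_scale M c (ae_class M f) = ae_class M (\<lambda>x. c * f x)"
proof (unfold L2_scale_def, rule ae_class_cong)
  show "AE x in M. c * rep (ae_class M f) x = c * f x"
    using rep_ae_class(2)[OF assms] by eventually_elim simp
qed

lemma L2_norm_ae_class:
  assumes [measurable]: "f \<in> borel_measurable M"
  shows "L2_norm M (ae_class M f) = sqrt (LINT x|M. (norm (f x))\<^sup>2)"
proof -
  note [measurable] = rep_ae_class(1)[OF assms]
  have "(LINT x|M. (norm (rep (ae_class M f) x))\<^sup>2) = (LINT x|M. (norm (f x))\<^sup>2)"
    using rep_ae_class(2)[OF assms] by (intro integral_cong_AE) auto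
  then show ?thesis by (simp add: L2_norm_def)
qed

lemma (in measure_preserving_system) distr_map: "distr M M \<phi> = M"
  by (rule measure_eqI)
     (simp_all add: emeasure_distr measurable_map emeasure_eq_measure measure_vimage)

lemma (in measure_preserving_system) koopman_ae_class:
  assumes "f \<in> borel_measurable M"
  shows "koopman M \<phi> (ae_class M f) = ae_class M (f \<circ> \<phi>)"
proof -
  have "AE x in distr M M \<phi>. rep (ae_class M f) x = f x"
    unfolding distr_map by (rule rep_ae_class(2)[OF assms])
  then have "AE x in M. rep (ae_class M f) (\<phi> x) = f (\<phi> x)"
    by (rule AE_distrD[OF measurable_map])
  then show ?thesis
    unfolding koopman_def by (intro ae_class_cong) simp
qed


subsection \<open>Partitions and entropy\<close>

definition finite_measurable_partition :: "'a measure \<Rightarrow> 'a set set \<Rightarrow> bool" where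
  "finite_measurable_partition M \<alpha> \<longleftrightarrow> finite \<alpha> \<and> \<alpha> \<subseteq> sets M \<and> partition_on (space M) \<alpha>"

text \<open>The linear span of the classes of the indicator functions of the sets in \<open>\<alpha>\<close>.\<close>

definition L2_partition :: "'a measure \<Rightarrow> 'a set set \<Rightarrow>
    ('a \<Rightarrow> 'k::{real_normed_field, euclidean_space}) set set" where
  "L2_partition M \<alpha> = {ae_class M (\<lambda>x. \<Sum>A\<in>\<alpha>. c A * indicator A x) | c. True}"

lemma (in prob_space) L2_partition_subset_L2:
  assumes "finite_measurable_partition M \<alpha>"
  shows "L2_partition M \<alpha> \<subseteq> L2 M"
proof
  fix F :: "('a \<Rightarrow> 'k::{real_normed_field, euclidean_space}) set"
  assume "F \<in> L2_partition M \<alpha>"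
  then obtain c :: "'a set \<Rightarrow> 'k" where F: "F = ae_class M (\<lambda>x. \<Sum>A\<in>\<alpha>. c A * indicator A x)"
    by (auto simp: L2_partition_def)
  let ?f = "\<lambda>x. \<Sum>A\<in>\<alpha>. c A * indicator A x"
  have f: "?f \<in> borel_measurable M"
    using assms by (intro borel_measurable_sum) (auto simp: finite_measurable_partition_def)
  have bound: "norm (?f x) \<le> (\<Sum>A\<in>\<alpha>. norm (c A))" for x
    by (intro sum_norm_le) (auto simp: indicator_def)
  have "integrable M (\<lambda>x. (norm (?f x))\<^sup>2)"
  proof (rule integrable_const_bound)
    show "AE x in M. norm ((norm (?f x))\<^sup>2) \<le> (\<Sum>A\<in>\<alpha>. norm (c A))\<^sup>2"
      using bound by (auto intro!: power_mono)
    show "(\<lambda>x. (norm (?f x))\<^sup>2) \<in> borel_measurable M"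
      using f by measurable
  qed
  with f show "F \<in> L2 M"
    unfolding F L2_def by blast
qed

definition static_entropy :: "'a measure \<Rightarrow> 'a set set \<Rightarrow> real" where
  "static_entropy M \<alpha> = (\<Sum>A\<in>{A \<in> \<alpha>. measure M A \<noteq> 0}. - measure M A * ln (measure M A))"

text \<open>
  The sets below may include the empty set, which does not contribute to the static entropy.
  Intersecting with \<^term>\<open>space M\<close> only matters for the join of zero partitions.
\<close>

definition vimage_partition :: "'a measure \<Rightarrow> ('a \<Rightarrow> 'a) \<Rightarrow> 'a set set \<Rightarrow> 'a set set" where
  "vimage_partition M \<psi> \<alpha> = {\<psi> -` A \<inter> space M | A. A \<in> \<alpha>}"

definition join_partitions :: "'a measure \<Rightarrow> nat \<Rightarrow> (nat \<Rightarrow> 'a set set) \<Rightarrow> 'a set set" where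
  "join_partitions M n \<beta> = {space M \<inter> (\<Inter>k<n. B k) | B. \<forall>k<n. B k \<in> \<beta> k}"

definition entropy_of_partition :: "'a measure \<Rightarrow> ('a \<Rightarrow> 'a) \<Rightarrow> 'a set set \<Rightarrow> real" where
  "entropy_of_partition M \<phi> \<alpha> =
     lim (\<lambda>n. 1 / real n *
       static_entropy M (join_partitions M n (\<lambda>k. vimage_partition M (\<phi> ^^ k) \<alpha>)))"

end

theory Submission
  imports Defs
begin

(*
  Apply the hypothesis with k = 1. For cells A, B of the partition alpha, T 1_A is
  constant on B, so its L2-closeness to the indicator function of the preimage of A makes that
  preimage either almost contain or almost miss B. Hence the conditional entropy of the preimage
  partition given alpha is at most epsilon, for a delta that only depends on epsilon and on the
  cardinality. The entropies H_n of the iterated refinements form a concave sequence, so H_n / n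
  converges to a limit of at most H_2 - H_1, which is this conditional entropy.
*)

section \<open>Elementary inequalities for logarithms and finite entropy sums\<close>

text \<open>This is \<open>ln t \<le> t - 1\<close> at \<open>t = y / x\<close>, multiplied by
  \<open>x\<close>. It serves as a pointwise Gibbs inequality, and later bounds the entropy
  contribution of a set that almost fills its cell.\<close>

lemma mult_ln_ratio_le:
  fixes x y :: real
  assumes "0 \<le> x" "0 < y"
  shows "x * ln y - x * ln x \<le> y - x"
proof (cases "x = 0")
  case False
  with assms have "x > 0" by simp
  then have "x * ln (y / x) \<le> x * (y / x - 1)"
    using assms by (intro mult_left_mono ln_le_minus_one) auto
  then show ?thesis
    using \<open>x > 0\<close> assms by (simp add: ln_div algebra_simps)
qed (use assms in auto)

text \<open>Again \<open>ln t \<le> t - 1\<close>, now at \<open>t = 1 / sqrt x\<close>. The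
  explicit rate at which \<open>- x * ln x\<close> vanishes at 0 is what makes an explicit tolerance
  possible.\<close>

lemma neg_mult_ln_le_sqrt:
  fixes x :: real
  assumes "0 \<le> x"
  shows "- x * ln x \<le> 2 * sqrt x"
proof (cases "x = 0")
  case False
  with assms have "x > 0" by simp
  have "- ln (sqrt x) \<le> 1 / sqrt x"
    using ln_le_minus_one[of "1 / sqrt x"] \<open>x > 0\<close> by (simp add: ln_div)
  then have "2 * x * (- ln (sqrt x)) \<le> 2 * x * (1 / sqrt x)"
    using \<open>x > 0\<close> by (intro mult_left_mono) auto
  moreover have "x / sqrt x = sqrt x"
    using \<open>x > 0\<close> by (simp add: real_div_sqrt)
  ultimately show ?thesis
    using \<open>x > 0\<close> by (simp add: ln_sqrt)
qed simp

text \<open>Gibbs' inequality compares \<open>r\<close> with the product of its marginals, rescaled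
  to the same total mass \<open>s\<close>. No normalisation \<open>s = 1\<close> is imposed, at the
  price of the term \<open>- s * ln s\<close>: the lemma is applied inside a single cylinder of
  measure \<open>s\<close>, and summing over cylinders then yields the conditional form of
  subadditivity.\<close>

lemma entropy_subadditive:
  fixes r :: "'a \<Rightarrow> 'b \<Rightarrow> real"
  assumes fin: "finite A" "finite B" and nonneg: "\<And>a b. a \<in> A \<Longrightarrow> b \<in> B \<Longrightarrow> 0 \<le> r a b"
  defines "r\<^sub>A \<equiv> \<lambda>a. \<Sum>b\<in>B. r a b" and "r\<^sub>B \<equiv> \<lambda>b. \<Sum>a\<in>A. r a b" and "s \<equiv> \<Sum>a\<in>A. \<Sum>b\<in>B. r a b"
  shows "(\<Sum>a\<in>A. \<Sum>b\<in>B. - r a b * ln (r a b)) + - s * ln s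
    \<le> (\<Sum>a\<in>A. - r\<^sub>A a * ln (r\<^sub>A a)) + (\<Sum>b\<in>B. - r\<^sub>B b * ln (r\<^sub>B b))"
proof -
  have sA: "s = (\<Sum>a\<in>A. r\<^sub>A a)"
    by (simp add: s_def r\<^sub>A_def)
  have sB: "s = (\<Sum>b\<in>B. r\<^sub>B b)"
    unfolding s_def r\<^sub>B_def by (rule sum.swap)
  have rA0: "0 \<le> r\<^sub>A a" if "a \<in> A" for a
    unfolding r\<^sub>A_def using nonneg that by (intro sum_nonneg) auto
  have rB0: "0 \<le> r\<^sub>B b" if "b \<in> B" for b
    unfolding r\<^sub>B_def using nonneg that by (intro sum_nonneg) auto
  have s0: "0 \<le> s"
    unfolding sA using rA0 by (rule sum_nonneg)
  \<comment> \<open>If \<open>r a b\<close> vanishes, the left side is 0 and the right side is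
    nonnegative. Otherwise both marginals and \<open>s\<close> are positive, so the logarithm of
    \<open>r\<^sub>A a * r\<^sub>B b / s\<close> splits.\<close>
  have pointwise: "r a b * (ln (r\<^sub>A a) + ln (r\<^sub>B b) - ln s - ln (r a b)) \<le> r\<^sub>A a * r\<^sub>B b / s - r a b"
    if "a \<in> A" "b \<in> B" for a b
  proof (cases "r a b = 0")
    case True
    then show ?thesis using rA0[OF that(1)] rB0[OF that(2)] s0 by simp
  next
    case False
    with nonneg that have pos: "0 < r a b" by force
    also have "r a b \<le> r\<^sub>A a"
      unfolding r\<^sub>A_def using fin nonneg that by (intro member_le_sum) auto
    finally have A_pos: "0 < r\<^sub>A a" .
    have "r a b \<le> r\<^sub>B b"
      unfolding r\<^sub>B_def using fin nonneg that by (intro member_le_sum[where f = "\<lambda>a. r a b"]) auto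
    with pos have B_pos: "0 < r\<^sub>B b" by simp
    have "r\<^sub>A a \<le> s"
      unfolding sA using fin rA0 that by (intro member_le_sum) auto
    with A_pos have s_pos: "0 < s" by simp
    have "r a b * ln (r\<^sub>A a * r\<^sub>B b / s) - r a b * ln (r a b) \<le> r\<^sub>A a * r\<^sub>B b / s - r a b"
      using pos A_pos B_pos s_pos by (intro mult_ln_ratio_le) auto
    then show ?thesis
      using pos A_pos B_pos s_pos by (simp add: ln_div ln_mult algebra_simps)
  qed
  have "(\<Sum>a\<in>A. \<Sum>b\<in>B. r a b * (ln (r\<^sub>A a) + ln (r\<^sub>B b) - ln s - ln (r a b)))
      \<le> (\<Sum>a\<in>A. \<Sum>b\<in>B. r\<^sub>A a * r\<^sub>B b / s - r a b)"
    using pointwise by (intro sum_mono) auto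
  also have "\<dots> = (\<Sum>a\<in>A. r\<^sub>A a) * (\<Sum>b\<in>B. r\<^sub>B b) / s - s"
    by (simp add: sum_subtractf sum_product sum_divide_distrib s_def)
  \<comment> \<open>Both marginals sum to \<open>s\<close>. The identity survives
    \<open>s = 0\<close> because division by zero yields 0.\<close>
  also have "\<dots> = 0"
    by (simp flip: sA sB)
  finally have le: "(\<Sum>a\<in>A. \<Sum>b\<in>B. r a b * (ln (r\<^sub>A a) + ln (r\<^sub>B b) - ln s - ln (r a b))) \<le> 0" .
  have "(\<Sum>a\<in>A. \<Sum>b\<in>B. r a b * ln (r\<^sub>A a)) = (\<Sum>a\<in>A. r\<^sub>A a * ln (r\<^sub>A a))"
    by (simp add: r\<^sub>A_def sum_distrib_right)
  moreover have "(\<Sum>a\<in>A. \<Sum>b\<in>B. r a b * ln (r\<^sub>B b)) = (\<Sum>b\<in>B. r\<^sub>B b * ln (r\<^sub>B b))"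
    by (subst sum.swap) (simp add: r\<^sub>B_def sum_distrib_right)
  moreover have "(\<Sum>a\<in>A. \<Sum>b\<in>B. r a b * ln s) = s * ln s"
    by (simp add: s_def sum_distrib_right)
  ultimately show ?thesis
    using le by (simp add: distrib_left right_diff_distrib sum.distrib sum_subtractf sum_negf)
qed

section \<open>Averages of concave sequences\<close>

text \<open>The increments decrease by concavity, and \<open>a n / n\<close> is the mean of the
  first \<open>n\<close> of them, so it decreases as well and is bounded below by 0. All increments
  but the first are at most \<open>a 2 - a 1\<close>, and the weight of the first one tends to 0.
  Convergence must be proved on the way, since \<open>lim\<close> is only meaningful for convergent
  sequences.\<close>

lemma concave_mean_limit:
  fixes a :: "nat \<Rightarrow> real"
  assumes zero: "a 0 = 0" and nonneg: "\<And>n. 0 \<le> a n"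
    and concave: "\<And>n. a (Suc (Suc n)) + a n \<le> 2 * a (Suc n)"
  shows "lim (\<lambda>n. 1 / real n * a n) \<le> a 2 - a 1"
proof -
  define D where "D n = a (Suc n) - a n" for n
  have dec: "decseq D"
    using concave by (intro decseq_SucI) (simp add: D_def algebra_simps)
  have a_ge: "real n * D n \<le> a n" for n
  proof -
    have "real n * D n = (\<Sum>i<n. D n)"
      by simp
    also have "\<dots> \<le> (\<Sum>i<n. D i)"
      by (intro sum_mono decseqD[OF dec]) auto
    also have "\<dots> = a n"
      unfolding D_def using zero by (simp add: sum_lessThan_telescope)
    finally show ?thesis .
  qed
  \<comment> \<open>The index is shifted because the term at 0 has the default value 0, which would
    break monotonicity.\<close>
  define b where "b n = 1 / real (Suc n) * a (Suc n)" for n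
  have "decseq b"
  proof (rule decseq_SucI)
    fix n
    show "b (Suc n) \<le> b n"
      using a_ge[of "Suc n"] by (simp add: b_def D_def field_simps)
  qed
  moreover have "0 \<le> b n" for n
    using nonneg by (simp add: b_def)
  ultimately obtain L where L: "b \<longlonglongrightarrow> L"
    using decseq_convergent[of b 0] by blast
  then have "(\<lambda>n. 1 / real n * a n) \<longlonglongrightarrow> L"
    unfolding b_def by (rule LIMSEQ_imp_Suc)
  moreover have "L \<le> D 1"
  proof (rule LIMSEQ_le)
    show "b \<longlonglongrightarrow> L" by (rule L)
    have "(\<lambda>n. D 1 + (a 1 - D 1) / real (Suc n)) \<longlonglongrightarrow> D 1 + 0"
      by (intro tendsto_add tendsto_const LIMSEQ_Suc[OF lim_const_over_n])
    then show "(\<lambda>n. D 1 + (a 1 - D 1) / real (Suc n)) \<longlonglongrightarrow> D 1" by simp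
    \<comment> \<open>The bound is \<open>a 1 + n * D 1\<close>, arranged so that division by
      \<open>Suc n\<close> leaves \<open>D 1\<close> plus a null sequence.\<close>
    have "a (Suc n) \<le> real (Suc n) * D 1 + (a 1 - D 1)" for n
    proof (induction n)
      case (Suc n)
      moreover have "D (Suc n) \<le> D 1"
        by (rule decseqD[OF dec]) simp
      ultimately show ?case by (simp add: D_def algebra_simps)
    qed simp
    then have "b n \<le> (real (Suc n) * D 1 + (a 1 - D 1)) / real (Suc n)" for n
      unfolding b_def times_divide_eq_left mult_1 by (rule divide_right_mono) simp
    then show "\<exists>N. \<forall>n\<ge>N. b n \<le> D 1 + (a 1 - D 1) / real (Suc n)"
      by (simp add: add_divide_distrib del: of_nat_Suc)
  qed
  ultimately show ?thesis
    by (simp add: limI D_def numeral_2_eq_2)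
qed

section \<open>Words, cylinder sets and the entropy of iterated refinements\<close>

text \<open>Lists are used as labels because the concavity argument has to extend a word at either
  end.\<close>

definition words :: "'b set \<Rightarrow> nat \<Rightarrow> 'b list set" where
  "words \<alpha> n = {w. set w \<subseteq> \<alpha> \<and> length w = n}"

lemma words_0 [simp]: "words \<alpha> 0 = {[]}"
  by (auto simp: words_def)

lemma sum_words_Cons: "(\<Sum>w\<in>words \<alpha> (Suc n). f w) = (\<Sum>w\<in>words \<alpha> n. \<Sum>a\<in>\<alpha>. f (a # w))"
proof -
  have "bij_betw (\<lambda>(w, a). a # w) (words \<alpha> n \<times> \<alpha>) (words \<alpha> (Suc n))"
    by (rule bij_betwI[where g = "\<lambda>w. (tl w, hd w)"]) (auto simp: words_def length_Suc_conv)
  from sum.reindex_bij_betw[OF this, of f, symmetric] show ?thesis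
    by (simp add: sum.cartesian_product split_def)
qed

lemma sum_words_snoc: "(\<Sum>w\<in>words \<alpha> (Suc n). f w) = (\<Sum>w\<in>words \<alpha> n. \<Sum>a\<in>\<alpha>. f (w @ [a]))"
proof -
  have "bij_betw (\<lambda>(w, a). w @ [a]) (words \<alpha> n \<times> \<alpha>) (words \<alpha> (Suc n))"
    by (rule bij_betwI[where g = "\<lambda>w. (butlast w, last w)"])
       (auto simp: words_def length_Suc_conv_rev)
  from sum.reindex_bij_betw[OF this, of f, symmetric] show ?thesis
    by (simp add: sum.cartesian_product split_def)
qed

context measure_preserving_system
begin

lemma measurable_iterate: "\<phi> ^^ k \<in> M \<rightarrow>\<^sub>M M"
  by (induction k) (auto simp: comp_def intro: measurable_compose[OF _ measurable_map])

text \<open>The cells of the iterated refinement, labelled by itineraries.\<close>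

definition cylinder :: "'a set list \<Rightarrow> 'a set" where
  "cylinder w = {x \<in> space M. \<forall>k<length w. (\<phi> ^^ k) x \<in> w ! k}"

lemma cylinder_Nil [simp]: "cylinder [] = space M"
  by (simp add: cylinder_def)

text \<open>A new first letter delays all other letters by one time step, which is why the old
  cylinder is pulled back along \<open>\<phi>\<close>.\<close>

lemma cylinder_Cons: "cylinder (A # w) = (\<phi> -` cylinder w \<inter> space M) \<inter> A"
proof -
  have "x \<in> cylinder (A # w) \<longleftrightarrow> x \<in> space M \<and> x \<in> A \<and> (\<forall>k<length w. (\<phi> ^^ k) (\<phi> x) \<in> w ! k)" for x
    unfolding cylinder_def by (simp add: All_less_Suc2 funpow_swap1)
  then show ?thesis
    using measurable_space[OF measurable_map] by (auto simp: cylinder_def)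
qed

lemma cylinder_snoc: "cylinder (w @ [A]) = cylinder w \<inter> (\<phi> ^^ length w) -` A"
  by (auto simp: cylinder_def nth_append less_Suc_eq)

lemma cylinder_sets: "set w \<subseteq> sets M \<Longrightarrow> cylinder w \<in> sets M"
  by (induction w) (auto simp: cylinder_Cons intro!: measurable_sets[OF measurable_map])

text \<open>The map \<open>\<psi>\<close> is kept general for three uses: the identity when a letter
  is prepended, an iterate of \<open>\<phi>\<close> when one is appended, and \<open>\<phi>\<close>
  itself in the conditional entropy.\<close>

lemma measure_eq_sum_partition:
  assumes \<alpha>: "finite_measurable_partition M \<alpha>" and E: "E \<in> sets M" and \<psi>: "\<psi> \<in> M \<rightarrow>\<^sub>M M"
  shows "(\<Sum>A\<in>\<alpha>. measure M (E \<inter> \<psi> -` A)) = measure M E"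
proof -
  have sub: "E \<subseteq> space M"
    using E by (rule sets.sets_into_space)
  have "E \<inter> \<psi> -` A \<in> sets M" if "A \<in> \<alpha>" for A
  proof -
    have "E \<inter> \<psi> -` A = E \<inter> (\<psi> -` A \<inter> space M)" using sub by auto
    also have "\<dots> \<in> sets M"
      using that \<alpha> E measurable_sets[OF \<psi>] by (auto simp: finite_measurable_partition_def)
    finally show ?thesis .
  qed
  moreover have "disjoint_family_on (\<lambda>A. E \<inter> \<psi> -` A) \<alpha>"
    using \<alpha> unfolding finite_measurable_partition_def partition_on_def disjoint_family_on_def disjoint_def
    by blast
  ultimately have "measure M (\<Union>A\<in>\<alpha>. E \<inter> \<psi> -` A) = (\<Sum>A\<in>\<alpha>. measure M (E \<inter> \<psi> -` A))"
    using \<alpha> by (intro finite_measure_finite_Union) (auto simp: finite_measurable_partition_def)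
  moreover have "(\<Union>A\<in>\<alpha>. E \<inter> \<psi> -` A) = E"
    using \<alpha> sub measurable_space[OF \<psi>]
    unfolding finite_measurable_partition_def partition_on_def by blast
  ultimately show ?thesis by simp
qed

text \<open>Summation over labels instead of cells; words with null cylinder contribute nothing, as
  \<open>0 * ln 0 = 0\<close>.\<close>

definition word_entropy :: "'a set set \<Rightarrow> nat \<Rightarrow> real" where
  "word_entropy \<alpha> n = (\<Sum>w\<in>words \<alpha> n. - measure M (cylinder w) * ln (measure M (cylinder w)))"

text \<open>The cells of the refinement are exactly the cylinders. Two words sharing a cylinder of
  nonzero measure share the itinerary of a common point, so they agree by disjointness of the cells
  of \<open>\<alpha>\<close>. Null cylinders are omitted from one sum and contribute 0 to the
  other.\<close>

lemma static_entropy_eq_word_entropy: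
  assumes \<alpha>: "finite_measurable_partition M \<alpha>"
  shows "static_entropy M (join_partitions M n (\<lambda>k. vimage_partition M (\<phi> ^^ k) \<alpha>)) = word_entropy \<alpha> n"
proof -
  let ?J = "join_partitions M n (\<lambda>k. vimage_partition M (\<phi> ^^ k) \<alpha>)"
  have J: "?J = cylinder ` words \<alpha> n"
  proof (intro equalityI subsetI)
    fix S assume "S \<in> ?J"
    then obtain B where S: "S = space M \<inter> (\<Inter>k<n. B k)"
      and "\<forall>k<n. \<exists>A. B k = (\<phi> ^^ k) -` A \<inter> space M \<and> A \<in> \<alpha>"
      by (auto simp: join_partitions_def vimage_partition_def)
    then obtain A where A: "\<And>k. k < n \<Longrightarrow> B k = (\<phi> ^^ k) -` A k \<inter> space M \<and> A k \<in> \<alpha>"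
      by metis
    have "S = cylinder (map A [0..<n])"
      unfolding S cylinder_def using A by auto
    moreover have "map A [0..<n] \<in> words \<alpha> n"
      using A by (auto simp: words_def)
    ultimately show "S \<in> cylinder ` words \<alpha> n" by blast
  next
    fix S assume "S \<in> cylinder ` words \<alpha> n"
    then obtain w where w: "w \<in> words \<alpha> n" and S: "S = cylinder w" by blast
    let ?B = "\<lambda>k. (\<phi> ^^ k) -` (w ! k) \<inter> space M"
    have "S = space M \<inter> (\<Inter>k<n. ?B k)"
      using w by (auto simp: S cylinder_def words_def)
    moreover have "\<forall>k<n. ?B k \<in> vimage_partition M (\<phi> ^^ k) \<alpha>"
    proof (intro allI impI)
      fix k assume "k < n"
      then have "w ! k \<in> \<alpha>" using w by (auto simp: words_def)
      then show "?B k \<in> vimage_partition M (\<phi> ^^ k) \<alpha>"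
        unfolding vimage_partition_def by blast
    qed
    ultimately show "S \<in> ?J"
      unfolding join_partitions_def by blast
  qed
  let ?W = "{w \<in> words \<alpha> n. measure M (cylinder w) \<noteq> 0}"
  have inj: "inj_on cylinder ?W"
  proof (rule inj_onI)
    fix v w assume vw: "v \<in> ?W" "w \<in> ?W" "cylinder v = cylinder w"
    then obtain x where x: "x \<in> cylinder v" "x \<in> cylinder w"
      by (metis (mono_tags) all_not_in_conv measure_empty mem_Collect_eq)
    show "v = w"
    proof (rule nth_equalityI)
      show "length v = length w" using vw by (auto simp: words_def)
      fix k assume k: "k < length v"
      then have "v ! k \<in> \<alpha>" "w ! k \<in> \<alpha>" using vw by (auto simp: words_def)
      moreover have "(\<phi> ^^ k) x \<in> v ! k \<inter> w ! k"
        using x k vw by (auto simp: cylinder_def words_def)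
      moreover have "disjoint \<alpha>"
        using \<alpha> by (simp add: finite_measurable_partition_def partition_on_def)
      ultimately show "v ! k = w ! k"
        unfolding disjoint_def by blast
    qed
  qed
  have "{S \<in> ?J. measure M S \<noteq> 0} = cylinder ` ?W"
    unfolding J by auto
  then have "static_entropy M ?J = (\<Sum>w\<in>?W. - measure M (cylinder w) * ln (measure M (cylinder w)))"
    unfolding static_entropy_def by (simp add: sum.reindex[OF inj])
  also have "\<dots> = word_entropy \<alpha> n"
    unfolding word_entropy_def using \<alpha>
    by (intro sum.mono_neutral_left)
       (auto simp: words_def finite_measurable_partition_def finite_lists_length_eq)
  finally show ?thesis .
qed

text \<open>Forgetting the first letter leaves the preimage of \<open>cylinder w\<close>, whose
  measure is that of \<open>cylinder w\<close> by invariance. This is the stationarity on which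
  concavity rests.\<close>

lemma sum_cylinder_Cons:
  assumes "finite_measurable_partition M \<alpha>" "set w \<subseteq> \<alpha>"
  shows "(\<Sum>A\<in>\<alpha>. measure M (cylinder (A # w))) = measure M (cylinder w)"
proof -
  have w: "cylinder w \<in> sets M"
    using assms by (intro cylinder_sets) (auto simp: finite_measurable_partition_def)
  show ?thesis
    using measure_eq_sum_partition[OF assms(1) measurable_sets[OF measurable_map w] measurable_ident]
    by (simp add: cylinder_Cons measure_vimage[OF w])
qed

lemma sum_cylinder_snoc:
  assumes "finite_measurable_partition M \<alpha>" "set w \<subseteq> \<alpha>"
  shows "(\<Sum>A\<in>\<alpha>. measure M (cylinder (w @ [A]))) = measure M (cylinder w)"
  unfolding cylinder_snoc using assms
  by (intro measure_eq_sum_partition cylinder_sets measurable_iterate)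
     (auto simp: finite_measurable_partition_def)

text \<open>Strong subadditivity: for each middle word \<open>w\<close>, subadditivity is applied to
  the joint distribution of the letter before and the letter after it, whose total mass is the
  measure of \<open>cylinder w\<close>. Summation over \<open>w\<close> gives the claim.\<close>

lemma word_entropy_concave:
  assumes \<alpha>: "finite_measurable_partition M \<alpha>"
  shows "word_entropy \<alpha> (Suc (Suc n)) + word_entropy \<alpha> n \<le> 2 * word_entropy \<alpha> (Suc n)"
proof -
  let ?p = "\<lambda>w. measure M (cylinder w)" and ?h = "\<lambda>w. - measure M (cylinder w) * ln (measure M (cylinder w))"
  have "(\<Sum>A\<in>\<alpha>. \<Sum>B\<in>\<alpha>. ?h (A # w @ [B])) + ?h w \<le> (\<Sum>A\<in>\<alpha>. ?h (A # w)) + (\<Sum>B\<in>\<alpha>. ?h (w @ [B]))"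
    if "w \<in> words \<alpha> n" for w
  proof -
    have w: "set w \<subseteq> \<alpha>" using that by (simp add: words_def)
    have "(\<Sum>B\<in>\<alpha>. ?p (A # w @ [B])) = ?p (A # w)" if "A \<in> \<alpha>" for A
      using sum_cylinder_snoc[OF \<alpha>, of "A # w"] that w by simp
    moreover have "(\<Sum>A\<in>\<alpha>. ?p (A # w @ [B])) = ?p (w @ [B])" if "B \<in> \<alpha>" for B
      using sum_cylinder_Cons[OF \<alpha>, of "w @ [B]"] that w by simp
    ultimately show ?thesis
      using entropy_subadditive[of \<alpha> \<alpha> "\<lambda>A B. ?p (A # w @ [B])"] \<alpha> sum_cylinder_Cons[OF \<alpha> w]
      by (simp add: finite_measurable_partition_def cong: sum.cong)
  qed
  then have "(\<Sum>w\<in>words \<alpha> n. (\<Sum>A\<in>\<alpha>. \<Sum>B\<in>\<alpha>. ?h (A # w @ [B])) + ?h w)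
      \<le> (\<Sum>w\<in>words \<alpha> n. (\<Sum>A\<in>\<alpha>. ?h (A # w)) + (\<Sum>B\<in>\<alpha>. ?h (w @ [B])))"
    by (rule sum_mono)
  moreover have "word_entropy \<alpha> (Suc (Suc n)) = (\<Sum>w\<in>words \<alpha> n. \<Sum>A\<in>\<alpha>. \<Sum>B\<in>\<alpha>. ?h (A # w @ [B]))"
    unfolding word_entropy_def
    by (subst sum_words_snoc, subst sum_words_Cons) simp
  \<comment> \<open>Words of length \<open>Suc n\<close> are decomposed in two ways, once for each
    marginal.\<close>
  moreover have "word_entropy \<alpha> (Suc n) = (\<Sum>w\<in>words \<alpha> n. \<Sum>A\<in>\<alpha>. ?h (A # w))"
    unfolding word_entropy_def by (rule sum_words_Cons)
  moreover have "word_entropy \<alpha> (Suc n) = (\<Sum>w\<in>words \<alpha> n. \<Sum>B\<in>\<alpha>. ?h (w @ [B]))"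
    unfolding word_entropy_def by (rule sum_words_snoc)
  moreover have "word_entropy \<alpha> n = (\<Sum>w\<in>words \<alpha> n. ?h w)"
    unfolding word_entropy_def ..
  ultimately show ?thesis
    by (simp only: sum.distrib)
qed

section \<open>Entropy bounded by the conditional entropy of the second letter given the
  first\<close>

lemma entropy_of_partition_le:
  assumes \<alpha>: "finite_measurable_partition M \<alpha>"
  shows "entropy_of_partition M \<phi> \<alpha> \<le> word_entropy \<alpha> 2 - word_entropy \<alpha> 1"
  unfolding entropy_of_partition_def static_entropy_eq_word_entropy[OF \<alpha>]
proof (rule concave_mean_limit)
  show "word_entropy \<alpha> 0 = 0"
    by (simp add: word_entropy_def prob_space)
  show "0 \<le> word_entropy \<alpha> n" for n
  proof -
    have "- x * ln x \<ge> 0" if "0 \<le> x" "x \<le> 1" for x :: real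
      using that by (cases "x = 0") (simp_all add: mult_le_0_iff)
    then show ?thesis
      unfolding word_entropy_def by (intro sum_nonneg) simp
  qed
qed (rule word_entropy_concave[OF \<alpha>])

text \<open>The difference is a sum of terms \<open>p * ln (q / p)\<close>, where \<open>q\<close>
  is the measure of a cell \<open>B\<close> and \<open>p\<close> that of its part mapped into
  \<open>A\<close>. Such a term is small if \<open>p\<close> is small, by the square root bound, and
  also if \<open>q - p\<close> is small, by the Gibbs bound. There are
  \<open>(card \<alpha>)^2\<close> terms, each at most \<open>4 * \<delta>\<close>.\<close>

lemma word_entropy_2_minus_1_le:
  assumes \<alpha>: "finite_measurable_partition M \<alpha>" and \<delta>: "0 \<le> \<delta>" "\<delta> \<le> 1"
    and approx: "\<And>A B. A \<in> \<alpha> \<Longrightarrow> B \<in> \<alpha> \<Longrightarrow>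
      min (measure M (B \<inter> \<phi> -` A)) (measure M (B - \<phi> -` A)) \<le> 2 * \<delta>\<^sup>2"
  shows "word_entropy \<alpha> 2 - word_entropy \<alpha> 1 \<le> (real (card \<alpha>))\<^sup>2 * (4 * \<delta>)"
proof -
  let ?p = "\<lambda>B A. measure M (B \<inter> \<phi> -` A)" and ?q = "\<lambda>B. measure M B"
  have sets: "B \<in> sets M" "B \<subseteq> space M" if "B \<in> \<alpha>" for B
    using \<alpha> that sets.sets_into_space by (auto simp: finite_measurable_partition_def)
  have sets2: "B \<inter> \<phi> -` A \<in> sets M" if "A \<in> \<alpha>" "B \<in> \<alpha>" for A B
  proof -
    have "B \<inter> \<phi> -` A = B \<inter> (\<phi> -` A \<inter> space M)" using sets that by auto
    then show ?thesis using sets that measurable_sets[OF measurable_map] by simp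
  qed
  have c1: "cylinder [B] = B" if "B \<in> \<alpha>" for B
    using sets[OF that] by (auto simp: cylinder_def)
  have c2: "cylinder [B, A] = B \<inter> \<phi> -` A" if "B \<in> \<alpha>" for A B
    using sets[OF that] by (auto simp: cylinder_def less_Suc_eq)
  \<comment> \<open>The factor \<open>measure M B\<close> is split according to the next letter, so
    that both entropies become sums over the same pairs.\<close>
  have h1: "word_entropy \<alpha> 1 = (\<Sum>B\<in>\<alpha>. \<Sum>A\<in>\<alpha>. - ?p B A * ln (?q B))"
  proof -
    have "word_entropy \<alpha> 1 = (\<Sum>B\<in>\<alpha>. - ?q B * ln (?q B))"
      using c1 by (simp add: word_entropy_def sum_words_Cons cong: sum.cong)
    also have "\<dots> = (\<Sum>B\<in>\<alpha>. \<Sum>A\<in>\<alpha>. - ?p B A * ln (?q B))"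
    proof (rule sum.cong)
      fix B assume "B \<in> \<alpha>"
      then show "- ?q B * ln (?q B) = (\<Sum>A\<in>\<alpha>. - ?p B A * ln (?q B))"
        using measure_eq_sum_partition[OF \<alpha> sets(1) measurable_map, of B]
        by (simp add: sum_negf flip: sum_distrib_right)
    qed simp
    finally show ?thesis .
  qed
  have h2: "word_entropy \<alpha> 2 = (\<Sum>B\<in>\<alpha>. \<Sum>A\<in>\<alpha>. - ?p B A * ln (?p B A))"
  proof -
    have "word_entropy \<alpha> 2 = (\<Sum>B\<in>\<alpha>. \<Sum>A\<in>\<alpha>. - measure M (cylinder [B, A]) * ln (measure M (cylinder [B, A])))"
      unfolding word_entropy_def numeral_2_eq_2
      by (subst sum_words_snoc, subst sum_words_Cons) simp
    then show ?thesis by (simp add: c2 cong: sum.cong)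
  qed
  have "word_entropy \<alpha> 2 - word_entropy \<alpha> 1 = (\<Sum>B\<in>\<alpha>. \<Sum>A\<in>\<alpha>. ?p B A * ln (?q B) - ?p B A * ln (?p B A))"
    unfolding h1 h2 by (simp add: sum_negf sum_subtractf)
  also have "\<dots> \<le> (\<Sum>B\<in>\<alpha>. \<Sum>A\<in>\<alpha>. 4 * \<delta>)"
  proof (intro sum_mono)
    fix A B assume AB: "B \<in> \<alpha>" "A \<in> \<alpha>"
    have pq: "?p B A \<le> ?q B"
      using sets AB by (intro finite_measure_mono) auto
    show "?p B A * ln (?q B) - ?p B A * ln (?p B A) \<le> 4 * \<delta>"
    proof (cases "?p B A = 0")
      case True
      then show ?thesis using \<delta> by simp
    next
      case False
      then have pos: "0 < ?p B A" by (simp add: zero_less_measure_iff)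
      have "measure M (B - \<phi> -` A) = ?q B - ?p B A"
        using finite_measure_Diff[OF sets(1)[OF AB(1)] sets2[OF AB(2,1)]] by (simp add: Diff_Int)
      then consider "?p B A \<le> 2 * \<delta>\<^sup>2" | "?q B - ?p B A \<le> 2 * \<delta>\<^sup>2"
        using approx[OF AB(2,1)] by (auto simp: min_def split: if_splits)
      then show ?thesis
      proof cases
        case 1
        have "ln (?q B) \<le> 0"
          using pos pq by simp
        then have "?p B A * ln (?q B) \<le> 0"
          using pos by (simp add: mult_le_0_iff)
        moreover have "- ?p B A * ln (?p B A) \<le> 2 * sqrt (?p B A)"
          by (rule neg_mult_ln_le_sqrt) simp
        \<comment> \<open>Together with the factor 2 of the square root bound this yields the
          constant 4 of the claim.\<close>
        moreover have "sqrt (?p B A) \<le> 2 * \<delta>"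
        proof (rule real_le_lsqrt)
          show "?p B A \<le> (2 * \<delta>)\<^sup>2"
            unfolding power_mult_distrib using 1 zero_le_power2[of \<delta>] by (auto intro: order_trans)
        qed (use \<delta> in auto)
        ultimately show ?thesis by simp
      next
        case 2
        have "?p B A * ln (?q B) - ?p B A * ln (?p B A) \<le> ?q B - ?p B A"
          using pos pq by (intro mult_ln_ratio_le) auto
        also note 2
        also have "2 * \<delta>\<^sup>2 \<le> 4 * \<delta>"
          using mult_left_mono[OF \<delta>(2,1)] \<delta> by (simp add: power2_eq_square)
        finally show ?thesis .
      qed
    qed
  qed
  also have "\<dots> = (real (card \<alpha>))\<^sup>2 * (4 * \<delta>)"
    by (simp add: power2_eq_square)
  finally show ?thesis .
qed

section \<open>From closeness in the square norm to almost inclusion of cells\<close>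

text \<open>On \<open>B\<close> the approximant is a constant \<open>c B\<close>, whereas the
  transported indicator is 1 on one part of \<open>B\<close> and 0 on the other. Since
  \<open>c B\<close> cannot be close to both values, one of the two parts must have small
  measure.\<close>

lemma partition_approximation:
  fixes F :: "('a \<Rightarrow> 'k::{real_normed_field, euclidean_space}) set"
  assumes \<alpha>: "finite_measurable_partition M \<alpha>" and AB: "A \<in> sets M" "B \<in> \<alpha>"
    and F: "F \<in> L2_partition M \<alpha>" and "0 \<le> \<delta>"
    and le: "L2_norm M (L2_diff M F (koopman M \<phi> (ae_class M (indicator A)))) \<le> \<delta>"
  shows "min (measure M (B \<inter> \<phi> -` A)) (measure M (B - \<phi> -` A)) \<le> 2 * \<delta>\<^sup>2"
proof -
  obtain c :: "'a set \<Rightarrow> 'k" where F: "F = ae_class M (\<lambda>x. \<Sum>A\<in>\<alpha>. c A * indicator A x)"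
    using F by (auto simp: L2_partition_def)
  let ?f = "\<lambda>x. \<Sum>A\<in>\<alpha>. c A * indicator A x"
  define g where "g x = ?f x - indicator A (\<phi> x)" for x
  define P where "P = \<phi> -` A \<inter> space M"
  note [measurable] = measurable_map AB(1)
  have [measurable]: "S \<in> sets M" if "S \<in> \<alpha>" for S
    using \<alpha> that by (auto simp: finite_measurable_partition_def)
  have B[measurable]: "B \<in> sets M" and BS: "B \<subseteq> space M"
    using \<alpha> AB sets.sets_into_space by (auto simp: finite_measurable_partition_def)
  have P[measurable]: "P \<in> sets M"
    unfolding P_def by (rule measurable_sets[OF measurable_map AB(1)])
  have f[measurable]: "?f \<in> borel_measurable M"
    by (intro borel_measurable_sum) simp
  have ind: "(indicator A :: 'a \<Rightarrow> 'k) \<circ> \<phi> \<in> borel_measurable M"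
    by (intro measurable_comp[OF measurable_map]) simp
  have g[measurable]: "g \<in> borel_measurable M"
    unfolding g_def using f ind by (intro borel_measurable_diff) (auto simp: comp_def)
  have "L2_diff M F (koopman M \<phi> (ae_class M (indicator A))) = ae_class M g"
    using koopman_ae_class[of "indicator A :: 'a \<Rightarrow> 'k"] ind f AB
    by (simp add: F L2_diff_ae_class g_def[abs_def] comp_def)
  with le have "sqrt (LINT x|M. (norm (g x))\<^sup>2) \<le> \<delta>"
    by (simp add: L2_norm_ae_class)
  then have int_le: "(LINT x|M. (norm (g x))\<^sup>2) \<le> \<delta>\<^sup>2"
    by (simp add: sqrt_le_D)
  let ?u = "(norm (c B - 1))\<^sup>2" and ?v = "(norm (c B))\<^sup>2"
  let ?p = "measure M (B \<inter> P)" and ?q = "measure M (B - P)"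
  have f_B: "?f x = c B" if "x \<in> B" for x
  proof -
    have "disjoint \<alpha>"
      using \<alpha> by (simp add: finite_measurable_partition_def partition_on_def)
    then have "x \<in> S \<longleftrightarrow> S = B" if "S \<in> \<alpha>" for S
      using AB(2) that \<open>x \<in> B\<close> unfolding disjoint_def by blast
    then have "?f x = (\<Sum>S\<in>\<alpha>. if S = B then c B else 0)"
      by (intro sum.cong) (simp_all add: indicator_def)
    then show ?thesis
      using \<alpha> AB(2) by (simp add: finite_measurable_partition_def)
  qed
  \<comment> \<open>Boundedness supplies integrability. This matters because a non-integrable
    function would have integral 0 by default and \<open>int_le\<close> would carry no
    information.\<close>
  have "norm (g x) \<le> (\<Sum>A\<in>\<alpha>. norm (c A)) + 1" for x
  proof -
    have "norm (?f x) \<le> (\<Sum>A\<in>\<alpha>. norm (c A))"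
      by (intro sum_norm_le) (auto simp: indicator_def)
    moreover have "norm (indicator A (\<phi> x) :: 'k) \<le> 1"
      by (simp add: indicator_def)
    ultimately show ?thesis
      unfolding g_def using norm_triangle_ineq4[of "?f x" "indicator A (\<phi> x)"] by linarith
  qed
  then have int: "integrable M (\<lambda>x. (norm (g x))\<^sup>2)"
    by (intro integrable_const_bound[where B = "((\<Sum>A\<in>\<alpha>. norm (c A)) + 1)\<^sup>2"])
       (auto intro!: power_mono)
  \<comment> \<open>The integrand on the right is the squared error restricted to \<open>B\<close>,
    where it takes the value \<open>?u\<close> inside \<open>P\<close> and \<open>?v\<close>
    outside.\<close>
  have "?u * ?p + ?v * ?q = (LINT x|M. ?u * indicator (B \<inter> P) x + ?v * indicator (B - P) x)"
    by (subst Bochner_Integration.integral_add) (auto simp: emeasure_eq_measure Int_absorb2 sets.sets_into_space)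
  also have "\<dots> \<le> (LINT x|M. (norm (g x))\<^sup>2)"
  proof (rule integral_mono[OF _ int])
    fix x assume "x \<in> space M"
    then show "?u * indicator (B \<inter> P) x + ?v * indicator (B - P) x \<le> (norm (g x))\<^sup>2"
      using f_B by (auto simp: g_def P_def indicator_def)
  qed (auto simp: emeasure_eq_measure)
  also note int_le
  finally have upper: "?u * ?p + ?v * ?q \<le> \<delta>\<^sup>2" .
  \<comment> \<open>The distances of \<open>c B\<close> to 1 and to 0 add up to at least 1, so their
    squares add up to at least 1/2; this is the origin of the factor 2 in the claim.\<close>
  have "norm (1 :: 'k) \<le> norm (c B - 1) + norm (c B)"
    using norm_triangle_ineq4[of "c B" "c B - 1"] by simp
  then have "1\<^sup>2 \<le> (norm (c B - 1) + norm (c B))\<^sup>2"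
    by (intro power_mono) auto
  moreover have "(norm (c B - 1) + norm (c B))\<^sup>2 \<le> 2 * (?u + ?v)"
    using sum_squares_bound[of "norm (c B - 1)" "norm (c B)"] by (simp add: power2_sum)
  ultimately have uv: "1 / 2 \<le> ?u + ?v" by simp
  have "1 / 2 * min ?p ?q \<le> (?u + ?v) * min ?p ?q"
    using uv by (intro mult_right_mono) auto
  also have "\<dots> \<le> ?u * ?p + ?v * ?q"
    unfolding distrib_right by (intro add_mono mult_left_mono) auto
  also note upper
  finally have "min ?p ?q \<le> 2 * \<delta>\<^sup>2" by simp
  moreover have "B \<inter> P = B \<inter> \<phi> -` A" "B - P = B - \<phi> -` A"
    using BS by (auto simp: P_def)
  ultimately show ?thesis by simp
qed

lemma indicator_in_L2_partition:
  assumes "finite_measurable_partition M \<alpha>" "A \<in> \<alpha>"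
  shows "ae_class M (indicator A :: 'a \<Rightarrow> 'k::{real_normed_field, euclidean_space}) \<in> L2_partition M \<alpha>"
proof -
  have eq: "(\<lambda>x. \<Sum>S\<in>\<alpha>. (if S = A then 1 else 0) * indicator S x) = (indicator A :: 'a \<Rightarrow> 'k)"
    using assms by (simp add: finite_measurable_partition_def if_distrib[of "\<lambda>c. c * _"] cong: if_cong)
  show ?thesis
    unfolding L2_partition_def mem_Collect_eq
    by (rule exI[of _ "\<lambda>S. if S = A then 1 else 0"]) (simp only: eq simp_thms)
qed

lemma L2_norm_indicator_le_1:
  assumes "A \<in> sets M"
  shows "L2_norm M (ae_class M (indicator A :: 'a \<Rightarrow> 'k::{real_normed_field, euclidean_space})) \<le> 1"
proof -
  have "(LINT x|M. (norm (indicator A x :: 'k))\<^sup>2) = (LINT x|M. indicator A x)"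
    by (intro Bochner_Integration.integral_cong) (auto simp: indicator_def)
  also have "\<dots> \<le> 1"
    using assms by simp
  finally show ?thesis
    using assms by (simp add: L2_norm_ae_class)
qed

end

section \<open>Choice of the tolerance and conclusion\<close>

theorem theorem1p1:
  fixes M :: "'a measure" and \<phi> :: "'a \<Rightarrow> 'a" and \<epsilon> :: real and N :: nat
  assumes "measure_preserving_system M \<phi>" and "\<epsilon> > 0"
  shows "\<exists>\<delta>::real. \<delta> > 0 \<and>
    (\<forall>\<alpha>. finite_measurable_partition M \<alpha> \<and> card \<alpha> = N \<longrightarrow>
      (\<exists>K\<^sub>0::nat. \<forall>K\<ge>K\<^sub>0.
        \<forall>T :: ('a \<Rightarrow> 'k::{real_normed_field, euclidean_space}) set \<Rightarrow> ('a \<Rightarrow> 'k) set.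
          L2_linear_operator_on M (L2_partition M \<alpha>) T \<and>
          (\<forall>F\<in>L2_partition M \<alpha>. \<forall>k<K.
             L2_norm M (L2_diff M ((T ^^ k) F) ((koopman M \<phi> ^^ k) F)) \<le> \<delta> * L2_norm M F)
          \<longrightarrow> real (card \<alpha>) \<ge> exp (real K * (entropy_of_partition M \<phi> \<alpha> - \<epsilon>))))"
proof -
  interpret measure_preserving_system M \<phi> by (rule assms(1))
  \<comment> \<open>Chosen so that \<open>N^2 * (4 * \<delta>)\<close>, the bound on the conditional
    entropy, is at most \<open>\<epsilon>\<close>. The added 1 keeps the denominator positive for
    \<open>N = 0\<close>, and the minimum with 1 provides \<open>\<delta> \<le> 1\<close>.\<close>
  define \<delta> where "\<delta> = min 1 (\<epsilon> / (4 * ((real N)\<^sup>2 + 1)))"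
  have N_pos: "0 < 4 * ((real N)\<^sup>2 + 1)"
    by (simp add: add_nonneg_pos)
  then have \<delta>: "0 < \<delta>" "\<delta> \<le> 1"
    using assms(2) by (auto simp: \<delta>_def)
  have "\<delta> \<le> \<epsilon> / (4 * ((real N)\<^sup>2 + 1))"
    by (simp add: \<delta>_def)
  then have "\<delta> * (4 * ((real N)\<^sup>2 + 1)) \<le> \<epsilon>"
    using N_pos by (simp only: pos_le_divide_eq)
  then have small: "(real N)\<^sup>2 * (4 * \<delta>) \<le> \<epsilon>"
    using \<delta> by (simp add: algebra_simps)
  show ?thesis
  \<comment> \<open>The threshold 2 is the least one that brings \<open>k = 1\<close> into the range
    \<open>k < K\<close>.\<close>
  proof (intro exI[of _ \<delta>] conjI allI impI \<delta>(1) exI[of _ 2])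
    fix \<alpha> K and T :: "('a \<Rightarrow> 'k) set \<Rightarrow> ('a \<Rightarrow> 'k) set"
    assume \<alpha>_N: "finite_measurable_partition M \<alpha> \<and> card \<alpha> = N" and K: "(2::nat) \<le> K"
      and T: "L2_linear_operator_on M (L2_partition M \<alpha>) T \<and>
          (\<forall>F\<in>L2_partition M \<alpha>. \<forall>k<K.
             L2_norm M (L2_diff M ((T ^^ k) F) ((koopman M \<phi> ^^ k) F)) \<le> \<delta> * L2_norm M F)"
    from \<alpha>_N have \<alpha>: "finite_measurable_partition M \<alpha>" and N: "card \<alpha> = N" by auto
    have "min (measure M (B \<inter> \<phi> -` A)) (measure M (B - \<phi> -` A)) \<le> 2 * \<delta>\<^sup>2"
      if AB: "A \<in> \<alpha>" "B \<in> \<alpha>" for A B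
    proof (rule partition_approximation)
      let ?F = "ae_class M (indicator A :: 'a \<Rightarrow> 'k)"
      have A: "A \<in> sets M"
        using \<alpha> AB by (auto simp: finite_measurable_partition_def)
      then show "A \<in> sets M" .
      have F: "?F \<in> L2_partition M \<alpha>"
        by (rule indicator_in_L2_partition[OF \<alpha> AB(1)])
      then show "T ?F \<in> L2_partition M \<alpha>"
        using T by (auto simp: L2_linear_operator_on_def)
      have "L2_norm M (L2_diff M ((T ^^ 1) ?F) ((koopman M \<phi> ^^ 1) ?F)) \<le> \<delta> * L2_norm M ?F"
        using T F K by (metis less_le_trans one_less_numeral_iff semiring_norm(76))
      \<comment> \<open>Indicators have norm at most 1, so the relative error bound becomes an
        absolute one.\<close>
      also have "\<dots> \<le> \<delta> * 1"
        using \<delta> L2_norm_indicator_le_1[OF A] by (intro mult_left_mono) auto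
      finally show "L2_norm M (L2_diff M (T ?F) (koopman M \<phi> ?F)) \<le> \<delta>"
        by simp
    qed (use \<alpha> AB \<delta> in auto)
    then have "entropy_of_partition M \<phi> \<alpha> \<le> \<epsilon>"
      using entropy_of_partition_le[OF \<alpha>] word_entropy_2_minus_1_le[OF \<alpha>, of \<delta>] \<delta> small N
      by fastforce
    \<comment> \<open>The exponent is nonpositive, so only \<open>1 \<le> card \<alpha>\<close> is
      left, which holds because a probability space is nonempty.\<close>
    then have "exp (real K * (entropy_of_partition M \<phi> \<alpha> - \<epsilon>)) \<le> 1"
      by (simp add: mult_le_0_iff)
    also have "\<alpha> \<noteq> {}"
      using \<alpha> not_empty by (auto simp: finite_measurable_partition_def partition_on_def)
    then have "1 \<le> real (card \<alpha>)"
      using \<alpha> by (simp add: finite_measurable_partition_def card_gt_0_iff Suc_le_eq)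
    finally show "exp (real K * (entropy_of_partition M \<phi> \<alpha> - \<epsilon>)) \<le> real (card \<alpha>)" .
  qed
qed

end
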